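(* Let $n\ge1$, $1\le k\le n$, $A=\{a_1,\dots,a_n\}$ and $S$ the power set of $A$. For $u\in S$ let $f(u)=(s_1,\dots,s_n)$ with $s_j\equiv\#\{i: a_i\in u,\ i\mid j\}\pmod 2$. Let $\sigma(\{1\})$ denote the set of squarefree positive integers and $k\cdot\sigma(\{1\})=\{ks: s\in\sigma(\{1\})\}$. Then for $u\in S$: $u=\{a_i : 1\le i\le n,\ i\in k\cdot\sigma(\{1\})\}$ if and only if $f(u)$ is the string with $s_k=1$ and $s_j=0$ for all $j\neq k$.
   Context: Locker problem: $n$ lockers numbered $1,\dots,n$, initially all closed; each student $a_i\in u$ changes the state of every locker whose number is a multiple of $i$; $f(u)$ is the final state with $1$ = open, $0$ = closed. A positive integer is squarefree if no prime square divides it ($1$ is squarefree). *)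

theory Defs
  imports Main "HOL-Computational_Algebra.Squarefree"
begin

definition squarefree_nats :: "nat set" where
  "squarefree_nats = {s. 0 < s \<and> squarefree s}"

definition dilate :: "nat \<Rightarrow> nat set \<Rightarrow> nat set" where
  "dilate k B = {k * s | s. s \<in> B}"

text \<open>Students \<open>a 1, \<dots>, a n\<close> are indexed by \<open>{1..n}\<close>; the bits are the natural numbers
  0 (closed) and 1 (open). Entry \<open>j - 1\<close> of the list is the state of locker \<open>j\<close>: it starts
  closed and is toggled once by each student \<open>a i\<close> in \<open>u\<close> with \<open>i dvd j\<close>.\<close>

definition locker_string :: "nat \<Rightarrow> (nat \<Rightarrow> 'a) \<Rightarrow> 'a set \<Rightarrow> nat list" where
  "locker_string n a u =
     map (\<lambda>j. card {i \<in> {1..n}. a i \<in> u \<and> i dvd j} mod 2) [1..<Suc n]"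

end

theory Submission
  imports Defs
begin

text \<open>
  Locker \<open>j\<close> is affected only by students numbered at most \<open>j\<close>, and student \<open>j\<close> does toggle it;
  so the set of students can be read off the final string one locker at a time, and \<open>f\<close> is
  injective. It therefore suffices to compute the string of \<open>k \<cdot> \<sigma>({1})\<close>: the students
  touching locker \<open>k m\<close> correspond to the squarefree divisors of \<open>m\<close>, and multiplication by a
  fixed prime divisor of \<open>m\<close> pairs these off unless \<open>m = 1\<close>.
\<close>

lemma even_card_squarefree_divisors:
  fixes m :: nat
  assumes "0 < m" "m \<noteq> 1"
  shows "even (card {d. d dvd m \<and> squarefree d})"
proof -
  obtain p where p: "prime p" "p dvd m"
    using assms(2) prime_factor_nat by blast
  have p0: "p > 0" using p(1) prime_gt_0_nat by blast
  define X where "X = {d. d dvd m \<and> squarefree d \<and> \<not> p dvd d}"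
  have finX: "finite X"
    unfolding X_def using finite_divisors_nat[OF assms(1)] by (rule rev_finite_subset) blast
  \<comment> \<open>Squarefree divisors divisible by \<open>p\<close> are exactly the multiples
    \<open>p * e\<close> with \<open>e\<close> in \<open>X\<close>: the factor \<open>p\<close>
    occurs only once, so dividing it out leaves an element of \<open>X\<close>.\<close>
  have split: "{d. d dvd m \<and> squarefree d} = X \<union> (*) p ` X"
  proof (intro equalityI subsetI)
    fix d assume "d \<in> {d. d dvd m \<and> squarefree d}"
    then have d: "d dvd m" "squarefree d" by auto
    show "d \<in> X \<union> (*) p ` X"
    proof (cases "p dvd d")
      case True
      then obtain e where e: "d = p * e" by blast
      have "\<not> p dvd e"
      proof
        assume "p dvd e"
        then have "p\<^sup>2 dvd d" by (simp add: e power2_eq_square)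
        then have "p dvd 1" using d(2) unfolding squarefree_def by blast
        then show False using p(1) not_prime_unit by blast
      qed
      moreover have "e dvd m" using d(1) e dvd_mult_right by blast
      moreover have "squarefree e" using d(2) e squarefree_mono[of e d] by simp
      ultimately show ?thesis using e by (auto simp: X_def)
    qed (use d in \<open>auto simp: X_def\<close>)
  next
    fix d assume "d \<in> X \<union> (*) p ` X"
    then show "d \<in> {d. d dvd m \<and> squarefree d}"
    proof
      assume "d \<in> (*) p ` X"
      then obtain e where e: "d = p * e" "e dvd m" "squarefree e" "\<not> p dvd e"
        by (auto simp: X_def)
      \<comment> \<open>Coprimality serves twice: it makes the product of the two divisors
        \<open>p\<close> and \<open>e\<close> divide \<open>m\<close>, and it keeps that product
        squarefree.\<close>
      have cop: "coprime p e" using p(1) e(4) prime_imp_coprime by blast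
      then have "p * e dvd m" using p(2) e(2) divides_mult by blast
      moreover have "squarefree (p * e)"
        using cop e(3) squarefree_prime[of p] p(1) by (simp add: squarefree_mult_coprime)
      ultimately show ?thesis using e(1) by simp
    qed (simp add: X_def)
  qed
  have "card {d. d dvd m \<and> squarefree d} = card X + card ((*) p ` X)"
    unfolding split using finX by (intro card_Un_disjoint) (auto simp: X_def)
  also have "card ((*) p ` X) = card X"
    using p0 by (intro card_image) (auto simp: inj_on_def)
  finally show ?thesis by simp
qed

text \<open>The positive factor \<open>k\<close> cancels from \<open>k * s dvd k * m\<close>;
  positivity of \<open>s\<close> is automatic for a divisor of \<open>m > 0\<close>.\<close>

lemma divisors_in_dilate:
  assumes "0 < k" "0 < m"
  shows "{i. i \<in> dilate k squarefree_nats \<and> i dvd k * m} = (*) k ` {d. d dvd m \<and> squarefree d}"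
  using assms by (auto simp: dilate_def squarefree_nats_def intro: Nat.gr0I)

text \<open>If \<open>k\<close> does not divide \<open>j\<close>, no multiple of \<open>k\<close>
  divides \<open>j\<close> and the count is 0. Otherwise cancelling \<open>k\<close> leaves the
  squarefree divisors of \<open>m = j / k\<close>: an even number of them, except for the single
  divisor 1 when \<open>m = 1\<close>.\<close>

lemma card_divisors_in_dilate_mod_2:
  assumes "0 < k" "0 < j"
  shows "card {i. i \<in> dilate k squarefree_nats \<and> i dvd j} mod 2 = (if j = k then 1 else 0)"
proof (cases "k dvd j")
  case True
  then obtain m where m: "j = k * m" by blast
  then have m0: "0 < m" using assms(2) by simp
  have "card {i. i \<in> dilate k squarefree_nats \<and> i dvd j} = card {d. d dvd m \<and> squarefree d}"
    unfolding m divisors_in_dilate[OF assms(1) m0]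
    using assms(1) by (intro card_image) (auto simp: inj_on_def)
  moreover have "{d::nat. d dvd 1 \<and> squarefree d} = {1}" by auto
  ultimately show ?thesis
    using even_card_squarefree_divisors[OF m0] m assms(1) by (cases "m = 1") auto
next
  case False
  then have none: "{i. i \<in> dilate k squarefree_nats \<and> i dvd j} = {}"
    by (auto simp: dilate_def dest: dvd_mult_left)
  have "j \<noteq> k" using False by auto
  then show ?thesis unfolding none by simp
qed

text \<open>The divisibility matrix on \<open>{1..n}\<close> is triangular with ones on the
  diagonal, hence invertible mod 2. The strong induction is the forward substitution.\<close>

lemma eq_if_divisor_counts_mod_2_eq:
  fixes I J :: "nat set"
  assumes "I \<subseteq> {1..n}" "J \<subseteq> {1..n}"
    and counts: "\<And>j. j \<in> {1..n} \<Longrightarrow> card {i \<in> I. i dvd j} mod 2 = card {i \<in> J. i dvd j} mod 2"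
  shows "I = J"
proof -
  have "j \<in> I \<longleftrightarrow> j \<in> J" for j
  proof (induction j rule: less_induct)
    case (less j)
    show ?case
    proof (cases "j \<in> {1..n}")
      case True
      \<comment> \<open>By the induction hypothesis the proper divisors of \<open>j\<close> lying in
        \<open>I\<close> and in \<open>J\<close> form the same set \<open>L\<close>, so the two
        counts can differ only through \<open>j\<close> itself.\<close>
      define L where "L = {i \<in> I. i dvd j \<and> i < j}"
      have L: "L = {i \<in> J. i dvd j \<and> i < j}" using less by (auto simp: L_def)
      have fin: "finite L" "j \<notin> L" by (auto simp: L_def)
      have le: "i dvd j \<Longrightarrow> i = j \<or> i < j" for i
        using True dvd_imp_le[of i j] by auto
      have "{i \<in> I. i dvd j} = (if j \<in> I then insert j L else L)"
        using le by (auto simp: L_def)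
      moreover have "{i \<in> J. i dvd j} = (if j \<in> J then insert j L else L)"
        unfolding L using le by auto
      moreover have "card (insert j L) mod 2 \<noteq> card L mod 2"
        using fin by simp presburger
      ultimately show ?thesis
        using counts[OF True] by (metis (full_types))
    qed (use assms in auto)
  qed
  then show ?thesis by blast
qed

lemma locker_string_eq_iff:
  assumes "inj_on a {1..n}" "u \<subseteq> a ` {1..n}" "v \<subseteq> a ` {1..n}"
  shows "locker_string n a u = locker_string n a v \<longleftrightarrow> u = v"
proof
  \<comment> \<open>Passing to index sets turns the claim about students into one about subsets of
    \<open>{1..n}\<close>; a set of students is recovered as the image of its index set under
    \<open>a\<close>.\<close>
  define I where "I w = {i \<in> {1..n}. a i \<in> w}" for w
  assume eq: "locker_string n a u = locker_string n a v"
  have "I u = I v"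
  proof (rule eq_if_divisor_counts_mod_2_eq)
    fix j assume "j \<in> {1..n}"
    then show "card {i \<in> I u. i dvd j} mod 2 = card {i \<in> I v. i dvd j} mod 2"
      using eq by (auto simp: locker_string_def I_def conj_assoc)
  qed (auto simp: I_def)
  moreover have "w = a ` I w" if "w \<subseteq> a ` {1..n}" for w
    using that by (auto simp: I_def)
  ultimately show "u = v" using assms by metis
qed simp

lemma locker_string_dilate:
  assumes "0 < k" "inj_on a {1..n}"
  shows "locker_string n a {a i | i. 1 \<le> i \<and> i \<le> n \<and> i \<in> dilate k squarefree_nats} =
         map (\<lambda>j. if j = k then 1 else 0) [1..<Suc n]"
proof -
  let ?v = "{a i | i. 1 \<le> i \<and> i \<le> n \<and> i \<in> dilate k squarefree_nats}"
  \<comment> \<open>The bound \<open>i \<le> n\<close> is implied by \<open>i dvd j\<close> for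
    \<open>j\<close> in \<open>{1..n}\<close>, and injectivity of \<open>a\<close> ensures that no
    index outside the dilate names a student in \<open>?v\<close>.\<close>
  have "{i \<in> {1..n}. a i \<in> ?v \<and> i dvd j} = {i. i \<in> dilate k squarefree_nats \<and> i dvd j}"
    if j: "j \<in> {1..n}" for j
  proof -
    have "i \<in> {1..n}" if "i dvd j" for i
      using j that dvd_imp_le[of i j] dvd_pos_nat[of j i] by auto
    moreover have "a i \<in> ?v \<longleftrightarrow> i \<in> dilate k squarefree_nats" if "i \<in> {1..n}" for i
      using that assms(2) by (auto dest: inj_onD)
    ultimately show ?thesis by blast
  qed
  then show ?thesis
    unfolding locker_string_def
    using assms(1) by (intro map_cong) (auto simp: card_divisors_in_dilate_mod_2)
qed

theorem theorem10:
  fixes n k :: nat and a :: "nat \<Rightarrow> 'a" and u :: "'a set"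
  assumes "1 \<le> n" and "1 \<le> k" and "k \<le> n"
    and "inj_on a {1..n}"
    and "u \<in> Pow (a ` {1..n})"
  shows "u = {a i | i. 1 \<le> i \<and> i \<le> n \<and> i \<in> dilate k squarefree_nats} \<longleftrightarrow>
         locker_string n a u = map (\<lambda>j. if j = k then 1 else 0) [1..<Suc n]"
proof -
  let ?v = "{a i | i. 1 \<le> i \<and> i \<le> n \<and> i \<in> dilate k squarefree_nats}"
  have "?v \<subseteq> a ` {1..n}" by auto
  \<comment> \<open>Injectivity of the string map settles both directions at once: only the string
    of \<open>?v\<close> remains to be computed.\<close>
  then have "u = ?v \<longleftrightarrow> locker_string n a u = locker_string n a ?v"
    using locker_string_eq_iff[of a n u ?v] assms(4,5) by blast
  also have "locker_string n a ?v = map (\<lambda>j. if j = k then 1 else 0) [1..<Suc n]"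
    using assms(2,4) by (intro locker_string_dilate) auto
  finally show ?thesis .
qed

end
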